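(* Let $G$ be a graph. Then the following statements hold for every positive integer $k$. (i) If $G$ has a strong bramble of $\alpha$-order $k$, then $\alpha\text{-}\mathsf{tw}(G)\ge k$. (ii) If $\alpha\text{-}\mathsf{tw}(G)\ge 4k-2$, then $G$ has a strong bramble of $\alpha$-order at least $k$.
   Context: All graphs are finite, simple, and undirected. For $X\subseteq V(G)$, $\alpha(X)$ denotes the maximum size of an independent set in $G[X]$; $X$ is connected if $G[X]$ is connected. A strong bramble in $G$ is a collection $\mathcal{B}=\{B_1,\dots,B_n\}$ of connected sets $B_i\subseteq V(G)$ such that $B_i\cap B_j\ne\emptyset$ for all $i,j\in\{1,\dots,n\}$. A cover for $\mathcal{B}$ is a set $X\subseteq V(G)$ with $B_i\cap X\ne\emptyset$ for all $i$. The $\alpha$-order of $\mathcal{B}$ is $\min\{\alpha(X): X\subseteq V(G)\text{ is a cover for }\mathcal{B}\}$. A tree-decomposition of $G$ is a pair $(T,\beta)$ where $T$ is a tree and $\beta\colon V(T)\to 2^{V(G)}$ satisfies: $\bigcup_{t\in V(T)}\beta(t)=V(G)$; for every edge $e\in E(G)$ there is $t\in V(T)$ with $e\subseteq\beta(t)$; and for every $v\in V(G)$ the set $\{t\in V(T): v\in\beta(t)\}$ induces a subtree of $T$. Its $\alpha$-width is $\max_{t\in V(T)}\alpha(\beta(t))$. The tree-independence number $\alpha\text{-}\mathsf{tw}(G)$ is the minimum $\alpha$-width over all tree-decompositions of $G$. *)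

theory Defs
  imports "Graph_Theory.Graph_Theory"
begin

text \<open>
  A finite simple undirected graph is a \<open>graph\<close> of the AFP entry Graph_Theory: a finite,
  loop-free, symmetric digraph without parallel arcs, every edge \<open>{u, v}\<close> being represented by
  the two arcs \<open>(u, v)\<close> and \<open>(v, u)\<close>. We use its version \<open>pair_graph\<close> in which arcs are pairs.
\<close>

definition independent_set :: "('a, 'b) pre_digraph \<Rightarrow> 'a set \<Rightarrow> bool" where
  "independent_set H I \<longleftrightarrow> I \<subseteq> verts H \<and> (\<forall>u\<in>I. \<forall>v\<in>I. (u, v) \<notin> arcs_ends H)"

definition alpha :: "'a pair_pre_digraph \<Rightarrow> 'a set \<Rightarrow> nat" where
  "alpha G X = Max {card I | I. independent_set (with_proj G \<restriction> X) I}"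

text \<open>
  The library's \<open>connected\<close> excludes the graph without vertices. This is harmless for strong
  brambles, whose members are nonempty since \<open>B \<inter> B \<noteq> {}\<close>.
\<close>

definition connected_set :: "'a pair_pre_digraph \<Rightarrow> 'a set \<Rightarrow> bool" where
  "connected_set G X \<longleftrightarrow> X \<subseteq> pverts G \<and> connected (with_proj G \<restriction> X)"

definition strong_bramble :: "'a pair_pre_digraph \<Rightarrow> 'a set set \<Rightarrow> bool" where
  "strong_bramble G \<B> \<longleftrightarrow>
     (\<forall>B\<in>\<B>. connected_set G B) \<and> (\<forall>B\<in>\<B>. \<forall>C\<in>\<B>. B \<inter> C \<noteq> {})"

definition bramble_cover :: "'a pair_pre_digraph \<Rightarrow> 'a set set \<Rightarrow> 'a set \<Rightarrow> bool" where
  "bramble_cover G \<B> X \<longleftrightarrow> X \<subseteq> pverts G \<and> (\<forall>B\<in>\<B>. B \<inter> X \<noteq> {})"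

definition alpha_order :: "'a pair_pre_digraph \<Rightarrow> 'a set set \<Rightarrow> nat" where
  "alpha_order G \<B> = Min {alpha G X | X. bramble_cover G \<B> X}"

text \<open>
  The library's \<open>tree\<close> forbids all directed cycles and so, as \<open>u, v, u\<close> is one, is not the notion
  for symmetric digraphs. The cycles of an undirected simple graph are the directed cycles of
  length at least 3.
\<close>

definition undirected_tree :: "('a, 'b) pre_digraph \<Rightarrow> bool" where
  "undirected_tree T \<longleftrightarrow>
     graph T \<and> connected T \<and> \<not> (\<exists>p. pre_digraph.cycle T p \<and> 3 \<le> length p)"

definition tree_decomposition ::
    "'a pair_pre_digraph \<Rightarrow> 't pair_pre_digraph \<Rightarrow> ('t \<Rightarrow> 'a set) \<Rightarrow> bool" where
  "tree_decomposition G T \<beta> \<longleftrightarrow>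
     undirected_tree (with_proj T) \<and>
     (\<Union>t\<in>pverts T. \<beta> t) = pverts G \<and>
     (\<forall>(u, v)\<in>parcs G. \<exists>t\<in>pverts T. {u, v} \<subseteq> \<beta> t) \<and>
     (\<forall>v\<in>pverts G. undirected_tree (with_proj T \<restriction> {t \<in> pverts T. v \<in> \<beta> t}))"

definition alpha_width ::
    "'a pair_pre_digraph \<Rightarrow> 't pair_pre_digraph \<Rightarrow> ('t \<Rightarrow> 'a set) \<Rightarrow> nat" where
  "alpha_width G T \<beta> = Max {alpha G (\<beta> t) | t. t \<in> pverts T}"

text \<open>
  Trees are finite, so up to isomorphism every tree has its nodes in \<open>nat\<close>. The minimum is taken
  over a nonempty set, because of the decomposition with the single bag \<open>V(G)\<close>.
\<close>

definition tree_independence_number :: "'a pair_pre_digraph \<Rightarrow> nat" where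
  "tree_independence_number G =
     (LEAST w. \<exists>(T :: nat pair_pre_digraph) \<beta>. tree_decomposition G T \<beta> \<and> w = alpha_width G T \<beta>)"

end

theory Submission
  imports Defs
begin

text \<open>
  Write \<open>\<alpha>\<close> for the independence number of a vertex set.

  A strong bramble forces a large bag because subtrees of a tree have the Helly property. The
  nodes whose bags meet a given member of the bramble induce a subtree; any two of these subtrees
  meet, since two members share a vertex and this vertex lies in some bag. A node common to all of
  the subtrees has a bag that covers the bramble (\<open>strong_bramble_covered_by_bag\<close>).

  Conversely, suppose that no strong bramble has order at least \<open>k\<close>. Then every vertex set \<open>W\<close> with
  \<open>\<alpha>(W) \<le> 3k - 2\<close> has a set \<open>X\<close> with \<open>\<alpha>(X) \<le> k - 1\<close> such that
  \<open>\<alpha>(W \<inter> C) \<le> 2k - 2\<close> for each component \<open>C\<close> of \<open>G - X\<close>: otherwise the components \<open>C\<close> with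
  \<open>\<alpha>(W \<inter> C) \<ge> 2k - 1\<close>, over all choices of \<open>X\<close>, form a strong bramble of order at least \<open>k\<close>
  (\<open>strong_bramble_of_large_components\<close>). Such separators yield a tree decomposition from the root
  downwards (\<open>decomposition_of_separators\<close>). The task is to decompose \<open>W \<union> U\<close> with \<open>W\<close> inside the
  root bag, where \<open>U\<close> is a set of vertices all of whose neighbours lie in \<open>W \<union> U\<close>. The root bag is
  \<open>W \<union> (X \<inter> U)\<close>, which has independence number at most \<open>(3k - 2) + (k - 1) = 4k - 3\<close>. What
  remains of \<open>U\<close> in a component \<open>C\<close> is attached to the rest through
  \<open>X \<union> (W \<inter> C)\<close>, whose independence number is at most \<open>(k - 1) + (2k - 2) = 3k - 3\<close>.
  This leaves room for one vertex of \<open>C \<inter> U\<close> to join the set that has to be in the root bag, so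
  that the remaining part of \<open>U\<close> is strictly smaller at every level.
\<close>

section \<open>Connected sets of a relation\<close>

definition connected_in :: "'v rel \<Rightarrow> 'v set \<Rightarrow> bool" where
  "connected_in E S \<longleftrightarrow> (\<forall>x\<in>S. \<forall>y\<in>S. (x, y) \<in> rtrancl_on S E)"

lemma rtrancl_on_restrict: "rtrancl_on S (E \<inter> S \<times> S) = rtrancl_on S E"
proof (intro equalityI subrelI)
  fix x y assume "(x, y) \<in> rtrancl_on S E"
  then show "(x, y) \<in> rtrancl_on S (E \<inter> S \<times> S)"
    by (induct rule: rtrancl_on_induct) (auto intro: rtrancl_on_into_rtrancl_on)
qed (auto intro: rtrancl_on_mono[of "E \<inter> S \<times> S" E S S])

lemma connected_induce_iff:
  assumes "sym (parcs T)"
  shows "connected (with_proj T \<restriction> S) \<longleftrightarrow> S \<noteq> {} \<and> connected_in (parcs T) S"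
proof -
  have "parcs (mk_symmetric (with_proj T \<restriction> S)) = parcs T \<inter> S \<times> S"
    using assms by (auto simp: mk_symmetric_def dest: symD)
  moreover have "pverts (mk_symmetric (with_proj T \<restriction> S)) = S"
    by (simp add: mk_symmetric_def)
  ultimately show ?thesis
    by (auto simp: connected_def strongly_connected_def reachable_def connected_in_def
        rtrancl_on_restrict)
qed

lemma connected_in_step:
  assumes "connected_in E S" "v \<in> S" "S \<noteq> {v}"
  obtains w where "w \<in> S" "w \<noteq> v" "(v, w) \<in> E"
proof -
  obtain y where y: "y \<in> S" "y \<noteq> v" using assms by auto
  then have "(v, y) \<in> rtrancl_on S E" using assms by (auto simp: connected_in_def)
  then have "y \<noteq> v \<Longrightarrow> \<exists>w\<in>S. w \<noteq> v \<and> (v, w) \<in> E" 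
    by (induct rule: rtrancl_on_induct) auto
  then show ?thesis using y that by blast
qed

text \<open>
  A path between two other vertices that runs through \<open>v\<close> enters and leaves \<open>v\<close> through its
  only neighbour, so the detour can be cut out.
\<close>

lemma connected_in_remove_leaf:
  assumes "connected_in E S" "sym E"
    and leaf: "\<And>a b. \<lbrakk>a \<in> S; b \<in> S; (v, a) \<in> E; (v, b) \<in> E\<rbrakk> \<Longrightarrow> a = b"
  shows "connected_in E (S - {v})"
  unfolding connected_in_def
proof (intro ballI)
  fix x y assume x: "x \<in> S - {v}" and y: "y \<in> S - {v}"
  let ?R = "rtrancl_on (S - {v}) E"
  have "(x, y) \<in> rtrancl_on S E" using assms x y by (auto simp: connected_in_def)
  \<comment> \<open>while the path stands at \<open>v\<close>, the only vertex where it can continue is already reached\<close>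
  then have "if y = v then \<forall>w\<in>S. (v, w) \<in> E \<longrightarrow> w = v \<or> (x, w) \<in> ?R else (x, y) \<in> ?R"
  proof (induct rule: rtrancl_on_induct)
    case base then show ?case using x by auto
  next
    case (step y z)
    have zy: "(z, y) \<in> E" using step(2) \<open>sym E\<close> by (auto dest: symD)
    consider "y = v" "z = v" | "y = v" "z \<noteq> v" | "y \<noteq> v" "z = v" | "y \<noteq> v" "z \<noteq> v" by blast
    then show ?case
    proof cases
      case 3
      then show ?thesis using step zy leaf by (metis (full_types))
    next
      case 4
      then show ?thesis using step by (auto intro: rtrancl_on_into_rtrancl_on)
    qed (use step in auto)
  qed
  then show "(x, y) \<in> ?R" using y by auto
qed

section \<open>Acyclic relations and the Helly property\<close>

definition vertex_cycle :: "'v rel \<Rightarrow> 'v list \<Rightarrow> bool" where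
  "vertex_cycle E c \<longleftrightarrow> 3 \<le> length c \<and> distinct c \<and>
     (\<forall>i<length c. (c ! i, c ! (Suc i mod length c)) \<in> E)"

lemma longest_path_exists:
  assumes "finite V" "V \<noteq> {}"
  obtains p where "p \<noteq> []" "distinct p" "successively (\<lambda>x y. (x, y) \<in> E) p" "set p \<subseteq> V"
    "\<And>x. \<lbrakk>x \<in> V; (x, hd p) \<in> E\<rbrakk> \<Longrightarrow> x \<in> set p"
proof -
  let ?P = "\<lambda>p. p \<noteq> [] \<and> distinct p \<and> successively (\<lambda>x y. (x, y) \<in> E) p \<and> set p \<subseteq> V"
  obtain v where "v \<in> V" using assms by blast
  then have "?P [v]" by simp
  moreover have "\<forall>p. ?P p \<longrightarrow> length p < Suc (card V)"
    using assms by (metis card_mono distinct_card less_Suc_eq_le)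
  ultimately have "\<exists>p. ?P p \<and> (\<forall>q. ?P q \<longrightarrow> length q \<le> length p)"
    by (rule ex_has_greatest_nat)
  then obtain p where p: "?P p" and max: "\<And>q. ?P q \<Longrightarrow> length q \<le> length p" by blast
  have "x \<in> set p" if "x \<in> V" "(x, hd p) \<in> E" for x
  proof (rule ccontr)
    assume "x \<notin> set p"
    then have "?P (x # p)" using p that by (cases p) auto
    from max[OF this] show False by simp
  qed
  then show ?thesis using that p by blast
qed

text \<open>
  The first vertex \<open>v\<close> of a longest path has all its neighbours on the path, and a neighbour
  other than the second vertex would close a cycle.
\<close>

lemma acyclic_has_leaf:
  assumes "finite V" "V \<noteq> {}" "sym E" "irrefl E" and acyclic: "\<nexists>c. vertex_cycle E c"
  obtains v where "v \<in> V" "\<And>a b. \<lbrakk>a \<in> V; b \<in> V; (v, a) \<in> E; (v, b) \<in> E\<rbrakk> \<Longrightarrow> a = b"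
proof -
  obtain p where p: "p \<noteq> []" "distinct p" "successively (\<lambda>x y. (x, y) \<in> E) p" "set p \<subseteq> V"
    and max: "\<And>x. \<lbrakk>x \<in> V; (x, hd p) \<in> E\<rbrakk> \<Longrightarrow> x \<in> set p"
    using longest_path_exists[OF assms(1,2)] by metis
  have second: "a = p ! 1" if a: "a \<in> V" "(hd p, a) \<in> E" for a
  proof (rule ccontr)
    assume ne: "a \<noteq> p ! 1"
    have ahd: "(a, hd p) \<in> E" using a \<open>sym E\<close> by (auto dest: symD)
    then obtain j where j: "j < length p" "p ! j = a" using max a by (metis in_set_conv_nth)
    have "j \<noteq> 0" using ahd j p \<open>irrefl E\<close> by (metis hd_conv_nth irreflD)
    then have j2: "2 \<le> j" using ne j by (cases "j = 1") auto
    have "(p ! i, p ! (Suc i mod Suc j)) \<in> E" if "i < Suc j" for i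
    proof (cases "i = j")
      case True
      then show ?thesis using ahd j p by (simp add: hd_conv_nth)
    next
      case False
      then show ?thesis using that j p(3) by (simp add: successively_conv_nth)
    qed
    moreover have "length (take (Suc j) p) = Suc j" using j by simp
    ultimately have "vertex_cycle E (take (Suc j) p)"
      unfolding vertex_cycle_def using j2 p by simp
    then show False using acyclic by blast
  qed
  show ?thesis
  proof (rule that[of "hd p"])
    show "hd p \<in> V" using p by (metis hd_in_set subsetD)
    fix a b assume "a \<in> V" "b \<in> V" "(hd p, a) \<in> E" "(hd p, b) \<in> E"
    then show "a = b" using second by metis
  qed
qed

text \<open>
  Removing a leaf \<open>v\<close> from all sets of the family keeps them connected. It also keeps them
  pairwise intersecting: two sets that meet in \<open>v\<close> and are not the singleton of \<open>v\<close> both contain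
  the only neighbour of \<open>v\<close>.
\<close>

theorem acyclic_helly:
  assumes "finite V" "V \<noteq> {}" "sym E" "irrefl E" "\<nexists>c. vertex_cycle E c"
    and "\<And>S. S \<in> \<F> \<Longrightarrow> S \<subseteq> V \<and> connected_in E S"
    and "\<And>S S'. \<lbrakk>S \<in> \<F>; S' \<in> \<F>\<rbrakk> \<Longrightarrow> S \<inter> S' \<noteq> {}"
  shows "\<exists>t\<in>V. \<forall>S\<in>\<F>. t \<in> S"
  using assms(1,2,6,7)
proof (induction "card V" arbitrary: V \<F> rule: less_induct)
  case less
  obtain v where v: "v \<in> V"
    and leaf: "\<And>a b. \<lbrakk>a \<in> V; b \<in> V; (v, a) \<in> E; (v, b) \<in> E\<rbrakk> \<Longrightarrow> a = b"
    using acyclic_has_leaf[OF less(2,3) assms(3-5)] by metis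
  show ?case
  proof (cases "\<F> = {} \<or> {v} \<in> \<F>")
    case True
    then show ?thesis
    proof
      assume "{v} \<in> \<F>"
      then have "\<forall>S\<in>\<F>. v \<in> S" using less(5) by blast
      then show ?thesis using v by blast
    qed (use v in blast)
  next
    case False
    let ?F = "(\<lambda>S. S - {v}) ` \<F>"
    have meet: "(S - {v}) \<inter> (S' - {v}) \<noteq> {}" if S: "S \<in> \<F>" "S' \<in> \<F>" for S S'
    proof (cases "v \<in> S \<inter> S'")
      case True
      have "S \<noteq> {v}" "S' \<noteq> {v}" using False S by auto
      obtain w where w: "w \<in> S" "w \<noteq> v" "(v, w) \<in> E"
        using connected_in_step[of E S v] less(4) S(1) True \<open>S \<noteq> {v}\<close> by blast
      obtain w' where w': "w' \<in> S'" "w' \<noteq> v" "(v, w') \<in> E"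
        using connected_in_step[of E S' v] less(4) S(2) True \<open>S' \<noteq> {v}\<close> by blast
      have "w = w'" using leaf[of w w'] less(4) S w w' by blast
      then show ?thesis using w w' by blast
    qed (use less(5) S in blast)
    have "V - {v} \<noteq> {}"
    proof -
      obtain S where "S \<in> \<F>" using False by blast
      then show ?thesis using meet[of S S] less(4)[of S] by blast
    qed
    moreover have "card (V - {v}) < card V" using v less(2) by (rule card_Diff1_less[rotated])
    moreover have "S \<subseteq> V - {v} \<and> connected_in E S" if "S \<in> ?F" for S
    proof -
      obtain S0 where S0: "S0 \<in> \<F>" "S = S0 - {v}" using \<open>S \<in> ?F\<close> by blast
      have "S0 \<subseteq> V" "connected_in E S0" using less(4) S0 by auto
      then have "connected_in E (S0 - {v})"
        using leaf \<open>sym E\<close> by (intro connected_in_remove_leaf) auto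
      then show ?thesis using S0 \<open>S0 \<subseteq> V\<close> by blast
    qed
    moreover have "S \<inter> S' \<noteq> {}" if "S \<in> ?F" "S' \<in> ?F" for S S'
      using that meet by blast
    ultimately have "\<exists>t\<in>V - {v}. \<forall>S\<in>?F. t \<in> S"
      using less(2) by (intro less(1)) auto
    then show ?thesis by auto
  qed
qed

section \<open>Undirected trees\<close>

lemma pcas_conv_successively:
  "p \<noteq> [] \<Longrightarrow> pcas u p v \<longleftrightarrow>
     fst (hd p) = u \<and> snd (last p) = v \<and> successively (\<lambda>e f. snd e = fst f) p"
proof (induction p arbitrary: u)
  case (Cons e p)
  show ?case
  proof (cases "p = []")
    case False
    then have "successively (\<lambda>e f. snd e = fst f) (e # p) \<longleftrightarrow>
        snd e = fst (hd p) \<and> successively (\<lambda>e f. snd e = fst f) p"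
      by (simp add: successively_Cons)
    then show ?thesis using Cons.IH[OF False, of "snd e"] False by auto
  qed simp
qed simp

lemma tl_pawalk_verts: "pcas u p v \<Longrightarrow> tl (pawalk_verts u p) = map snd p"
proof (induction p arbitrary: u)
  case (Cons e p)
  then have "tl (pawalk_verts (snd e) p) = map snd p" by simp
  moreover have "pawalk_verts (snd e) p = hd (pawalk_verts (snd e) p) # tl (pawalk_verts (snd e) p)"
    by (cases p) simp_all
  moreover have "hd (pawalk_verts (snd e) p) = snd e" using Cons.prems by (cases p) simp_all
  ultimately show ?case by simp
qed simp

lemma cycle_with_proj_iff:
  "pre_digraph.cycle (with_proj T) p \<longleftrightarrow>
     p \<noteq> [] \<and> fst (hd p) \<in> pverts T \<and> set p \<subseteq> parcs T \<and> snd (last p) = fst (hd p) \<and>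
     successively (\<lambda>e f. snd e = fst f) p \<and> distinct (map snd p)"
  unfolding pre_digraph.cycle_def pre_digraph.awalk_def cas_with_proj_eq awalk_verts_with_proj_eq
  by (auto simp: tl_pawalk_verts pcas_conv_successively)

text \<open>
  A cycle is given by a list of arcs, and the heads of the arcs form the vertex list. The first
  head is the second vertex of the walk, hence the rotation of \<open>c\<close> in the converse direction.
\<close>

lemma cycle_iff_vertex_cycle:
  assumes "wf_digraph (with_proj T)"
  shows "(\<exists>p. pre_digraph.cycle (with_proj T) p \<and> 3 \<le> length p) \<longleftrightarrow> (\<exists>c. vertex_cycle (parcs T) c)"
proof
  assume "\<exists>p. pre_digraph.cycle (with_proj T) p \<and> 3 \<le> length p"
  then obtain p where p: "pre_digraph.cycle (with_proj T) p" "3 \<le> length p" by blast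
  note p' = p(1)[unfolded cycle_with_proj_iff]
  have "(snd (p ! i), snd (p ! (Suc i mod length p))) \<in> parcs T" if i: "i < length p" for i
  proof -
    have "snd (p ! i) = fst (p ! (Suc i mod length p))"
    proof (cases "Suc i = length p")
      case True
      then have "p ! i = last p" "p ! (Suc i mod length p) = hd p"
        using p' by (auto simp: last_conv_nth hd_conv_nth simp flip: True)
      then show ?thesis using p' by simp
    next
      case False
      then show ?thesis using p' i by (simp add: successively_conv_nth)
    qed
    moreover have "p ! (Suc i mod length p) \<in> parcs T"
      using p' by (meson length_greater_0_conv mod_less_divisor nth_mem subsetD)
    ultimately show ?thesis by simp
  qed
  then have "vertex_cycle (parcs T) (map snd p)"
    using p p' by (auto simp: vertex_cycle_def)
  then show "\<exists>c. vertex_cycle (parcs T) c" by blast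
next
  assume "\<exists>c. vertex_cycle (parcs T) c"
  then obtain c where c: "3 \<le> length c" "distinct c"
    and arcs: "\<And>i. i < length c \<Longrightarrow> (c ! i, c ! (Suc i mod length c)) \<in> parcs T"
    by (auto simp: vertex_cycle_def)
  define n where "n = length c"
  define p where "p = map (\<lambda>i. (c ! i, c ! (Suc i mod n))) [0..<n]"
  have n: "3 \<le> n" "length p = n" using c by (auto simp: n_def p_def)
  have nth: "p ! i = (c ! i, c ! (Suc i mod n))" if "i < n" for i
    using that by (simp add: p_def)
  have "map snd p = rotate1 c"
    using n by (auto simp: list_eq_iff_nth_eq nth nth_rotate1 n_def)
  then have "distinct (map snd p)" using c by simp
  moreover have "set p \<subseteq> parcs T" using arcs by (auto simp: p_def n_def)
  moreover have "p \<noteq> []" using n by auto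
  moreover from this have "hd p = p ! 0" "last p = p ! (n - 1)"
    using n by (auto simp: hd_conv_nth last_conv_nth)
  then have "snd (last p) = fst (hd p)" using n by (simp add: nth)
  moreover have "fst (hd p) \<in> pverts T"
    using wf_digraph.tail_in_verts[OF assms, of "hd p"]
      subsetD[OF \<open>set p \<subseteq> parcs T\<close> hd_in_set[OF \<open>p \<noteq> []\<close>]] by simp
  moreover have "successively (\<lambda>e f. snd e = fst f) p"
    using n by (simp add: successively_conv_nth nth)
  ultimately have "pre_digraph.cycle (with_proj T) p"
    by (simp add: cycle_with_proj_iff)
  then show "\<exists>p. pre_digraph.cycle (with_proj T) p \<and> 3 \<le> length p" using n by auto
qed

lemma undirected_tree_iff:
  "undirected_tree (with_proj T) \<longleftrightarrow>
     pair_graph T \<and> pverts T \<noteq> {} \<and> connected_in (parcs T) (pverts T) \<and>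
     (\<nexists>c. vertex_cycle (parcs T) c)"
proof (cases "pair_graph T")
  case True
  then interpret pair_graph T .
  have "sym (parcs T)" by (rule symI) (rule arcs_symmetric)
  moreover have "with_proj T \<restriction> pverts T = with_proj T"
    by (auto simp: induce_subgraph_def with_proj_def dest: in_arcsD1 in_arcsD2)
  ultimately have "connected (with_proj T) \<longleftrightarrow>
      pverts T \<noteq> {} \<and> connected_in (parcs T) (pverts T)"
    using connected_induce_iff[of T "pverts T"] by simp
  moreover have "graph (with_proj T)" by unfold_locales
  ultimately show ?thesis
    using True cycle_iff_vertex_cycle[OF wf_digraph_axioms]
    by (simp add: undirected_tree_def)
next
  case False
  then show ?thesis by (auto simp: undirected_tree_def intro: pair_graphI_graph)
qed

lemma undirected_tree_induce:
  assumes tree: "undirected_tree (with_proj T)"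
    and S: "S \<subseteq> pverts T" "S \<noteq> {}" "connected_in (parcs T) S"
  shows "undirected_tree (with_proj T \<restriction> S)"
proof -
  interpret pair_graph T using tree by (simp add: undirected_tree_iff)
  have sub: "subgraph (with_proj T \<restriction> S) (with_proj T)"
    using S(1) by (intro subgraph_induce_subgraphI) auto
  interpret H: digraph "with_proj T \<restriction> S"
    by (rule digraphI_induced) (use sub in auto)
  have sym: "sym (parcs T)" by (rule symI) (rule arcs_symmetric)
  then have "symmetric (with_proj T \<restriction> S)"
    by (auto simp: symmetric_def arcs_ends_def arc_to_ends_def intro!: symI dest: symD)
  then interpret H: graph "with_proj T \<restriction> S" by unfold_locales
  have "connected (with_proj T \<restriction> S)" using S sym by (simp add: connected_induce_iff)
  moreover have "\<not> (\<exists>p. pre_digraph.cycle (with_proj T \<restriction> S) p \<and> 3 \<le> length p)"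
    using tree subgraph_cycle[OF sub] by (auto simp: undirected_tree_def)
  ultimately show ?thesis using H.graph_axioms by (simp add: undirected_tree_def)
qed

definition parent_tree :: "nat \<Rightarrow> (nat \<Rightarrow> nat) \<Rightarrow> nat pair_pre_digraph" where
  "parent_tree n p =
     \<lparr> pverts = {..<n},
       parcs = {(i, p i) | i. 0 < i \<and> i < n} \<union> {(p i, i) | i. 0 < i \<and> i < n} \<rparr>"

lemma connected_in_parent_tree:
  assumes "\<And>i. \<lbrakk>0 < i; i < n\<rbrakk> \<Longrightarrow> p i < i"
    and S: "S \<subseteq> {..<n}" "r \<in> S" "\<And>i. \<lbrakk>i \<in> S; i \<noteq> r\<rbrakk> \<Longrightarrow> 0 < i \<and> p i \<in> S"
  shows "connected_in (parcs (parent_tree n p)) S"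
proof -
  let ?E = "parcs (parent_tree n p)"
  have "sym ?E" by (auto simp: parent_tree_def intro!: symI)
  then have sym: "sym (rtrancl_on S ?E)" by (rule rtrancl_on_sym)
  have root: "(r, i) \<in> rtrancl_on S ?E" if "i \<in> S" for i
    using that
  proof (induction i rule: less_induct)
    case (less i)
    show ?case
    proof (cases "i = r")
      case True then show ?thesis using S by simp
    next
      case False
      then have i: "0 < i" "i < n" "p i \<in> S" using S less(2) by auto
      then have "(r, p i) \<in> rtrancl_on S ?E" using less assms(1) by blast
      moreover have "(p i, i) \<in> ?E" using i by (auto simp: parent_tree_def)
      ultimately show ?thesis using less(2) by (rule rtrancl_on_into_rtrancl_on)
    qed
  qed
  show ?thesis
    unfolding connected_in_def using root sym by (meson rtrancl_on_trans symD)
qed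

text \<open>
  The largest vertex of a cycle would have two distinct smaller neighbours, but the only smaller
  neighbour of a vertex is its parent.
\<close>

lemma undirected_tree_parent_tree:
  assumes "0 < n" and p: "\<And>i. \<lbrakk>0 < i; i < n\<rbrakk> \<Longrightarrow> p i < i"
  shows "undirected_tree (with_proj (parent_tree n p))"
proof -
  let ?E = "parcs (parent_tree n p)"
  have lt: "p i < n" if "0 < i" "i < n" for i using p[OF that] that by simp
  have "finite ?E"
    by (rule finite_subset[of _ "{..<n} \<times> {..<n}"]) (auto simp: parent_tree_def lt)
  moreover have "sym ?E" by (auto simp: parent_tree_def intro!: symI)
  ultimately have "pair_graph (parent_tree n p)"
    by unfold_locales (auto simp: symmetric_def parent_tree_def lt dest: p)
  moreover have "connected_in ?E {..<n}"
    using p assms(1) by (intro connected_in_parent_tree[where r = 0]) (auto simp: lt)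
  moreover have "\<not> vertex_cycle ?E c" for c
  proof
    assume "vertex_cycle ?E c"
    then have c: "3 \<le> length c" "distinct c"
      and arcs: "\<And>i. i < length c \<Longrightarrow> (c ! i, c ! (Suc i mod length c)) \<in> ?E"
      by (auto simp: vertex_cycle_def)
    have "Max (set c) \<in> set c" using c by (intro Max_in) auto
    then obtain i where i: "i < length c" "c ! i = Max (set c)" by (auto simp: in_set_conv_nth)
    \<comment> \<open>the cyclic predecessor of \<open>i\<close>; it differs from the cyclic successor as the length is at least 3\<close>
    define j where "j = (if i = 0 then length c - 1 else i - 1)"
    have j: "j < length c" "Suc j mod length c = i" "Suc i mod length c \<noteq> j"
      using i c by (auto simp: j_def mod_Suc)
    have parent: "x = p (c ! i)" if "(c ! i, x) \<in> ?E" "x \<in> set c" for x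
    proof -
      have "x \<le> c ! i" using that i by simp
      moreover have "x = p (c ! i) \<or> (0 < x \<and> x < n \<and> c ! i = p x)"
        using that by (auto simp: parent_tree_def)
      ultimately show ?thesis using p[of x] by auto
    qed
    have "(c ! i, c ! j) \<in> ?E" using arcs[OF j(1)] j \<open>sym ?E\<close> by (auto dest: symD)
    then have "c ! j = p (c ! i)" using j by (intro parent) auto
    moreover have si: "Suc i mod length c < length c" using c by (intro mod_less_divisor) auto
    then have "c ! (Suc i mod length c) = p (c ! i)" using arcs[OF i(1)] by (intro parent) auto
    ultimately have "c ! (Suc i mod length c) = c ! j" by simp
    then show False using c(2) si j by (simp add: nth_eq_iff_index_eq)
  qed
  ultimately show ?thesis using assms(1) by (auto simp: undirected_tree_iff parent_tree_def)
qed

section \<open>Tree decompositions as lists of bags\<close>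

text \<open>
  Tree decompositions are built as lists of bags in which every bag meets the union of its
  predecessors inside a single one of them, which serves as its parent. The first bag is the root.
  Gluing two decompositions is then appending two lists.
\<close>

definition running_intersection :: "'a set list \<Rightarrow> bool" where
  "running_intersection bs \<longleftrightarrow> bs \<noteq> [] \<and>
     (\<forall>i. 0 < i \<and> i < length bs \<longrightarrow> (\<exists>j<i. bs ! i \<inter> \<Union> (set (take i bs)) \<subseteq> bs ! j))"

lemma running_intersection_append:
  assumes "running_intersection bs" "running_intersection cs"
    and "\<Union> (set bs) \<inter> \<Union> (set cs) \<subseteq> hd bs \<inter> hd cs"
  shows "running_intersection (bs @ cs)"
proof -
  let ?n = "length bs"
  have ne: "bs \<noteq> []" "cs \<noteq> []" using assms by (auto simp: running_intersection_def)
  have "\<exists>j<i. (bs @ cs) ! i \<inter> \<Union> (set (take i (bs @ cs))) \<subseteq> (bs @ cs) ! j"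
    if i: "0 < i" "i < length (bs @ cs)" for i
  proof -
    consider "i < ?n" | "i = ?n" | "i > ?n" by linarith
    then show ?thesis
    proof cases
      case 1
      then obtain j where "j < i" "bs ! i \<inter> \<Union> (set (take i bs)) \<subseteq> bs ! j"
        using assms(1) i by (auto simp: running_intersection_def)
      then show ?thesis using 1 by (auto simp: nth_append)
    next
      case 2
      have "cs ! 0 \<inter> \<Union> (set bs) \<subseteq> bs ! 0"
        using assms(3) ne by (cases bs; cases cs) auto
      then show ?thesis using 2 ne by (auto simp: nth_append)
    next
      case 3
      define m where "m = i - ?n"
      have m: "0 < m" "m < length cs" "i = ?n + m" using 3 i by (auto simp: m_def)
      then obtain j where j: "j < m" "cs ! m \<inter> \<Union> (set (take m cs)) \<subseteq> cs ! j"
        using assms(2) by (auto simp: running_intersection_def)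
      have "cs ! m \<inter> \<Union> (set bs) \<subseteq> hd cs" using assms(3) m nth_mem[of m cs] by blast
      moreover have "hd cs \<in> set (take m cs)" using m ne by (cases cs; cases m) auto
      ultimately have "cs ! m \<inter> \<Union> (set bs) \<subseteq> cs ! j" using j(2) by blast
      then have "?n + j < i" "(bs @ cs) ! i \<inter> \<Union> (set (take i (bs @ cs))) \<subseteq> (bs @ cs) ! (?n + j)"
        using m j by (auto simp: nth_append)
      then show ?thesis by blast
    qed
  qed
  then show ?thesis using ne by (auto simp: running_intersection_def)
qed

text \<open>
  The tree joins each index to the index of its parent bag. If \<open>v\<close> lies in the bag \<open>i\<close> and in an
  earlier bag, then it lies in the parent bag of \<open>i\<close>. So from each node of \<open>v\<close> the parents lead
  through nodes of \<open>v\<close> to the first one.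
\<close>

lemma tree_decomposition_of_bags:
  fixes G :: "'a pair_pre_digraph"
  assumes rip: "running_intersection bs" and union: "\<Union> (set bs) = pverts G"
    and edges: "\<And>u v. (u, v) \<in> parcs G \<Longrightarrow> \<exists>b\<in>set bs. u \<in> b \<and> v \<in> b"
  shows "\<exists>T :: nat pair_pre_digraph. tree_decomposition G T (\<lambda>i. bs ! i) \<and> pverts T = {..<length bs}"
proof -
  let ?n = "length bs"
  have "\<exists>p. \<forall>i. 0 < i \<and> i < ?n \<longrightarrow> p i < i \<and> bs ! i \<inter> \<Union> (set (take i bs)) \<subseteq> bs ! p i"
    using rip unfolding running_intersection_def by metis
  then obtain p where p: "\<And>i. \<lbrakk>0 < i; i < ?n\<rbrakk> \<Longrightarrow> p i < i"
    and sep: "\<And>i. \<lbrakk>0 < i; i < ?n\<rbrakk> \<Longrightarrow> bs ! i \<inter> \<Union> (set (take i bs)) \<subseteq> bs ! p i"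
    by blast
  have n: "0 < ?n" using rip by (auto simp: running_intersection_def)
  define T where "T = parent_tree ?n p"
  have tree: "undirected_tree (with_proj T)"
    unfolding T_def using n p by (rule undirected_tree_parent_tree)
  have verts: "pverts T = {..<?n}" by (simp add: T_def parent_tree_def)
  have bags: "set bs = (\<lambda>i. bs ! i) ` {..<?n}" by (auto simp: set_conv_nth)
  have "undirected_tree (with_proj T \<restriction> {t \<in> pverts T. v \<in> bs ! t})" if v: "v \<in> pverts G" for v
  proof (rule undirected_tree_induce[OF tree])
    let ?S = "{t \<in> pverts T. v \<in> bs ! t}"
    obtain b where "b \<in> set bs" "v \<in> b" using v union by blast
    then obtain i where "i < ?n" "bs ! i = b" by (metis in_set_conv_nth)
    then have i: "i \<in> ?S" using verts \<open>v \<in> b\<close> by simp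
    then show "?S \<noteq> {}" by blast
    show "?S \<subseteq> pverts T" by blast
    define r where "r = Min ?S"
    have fin: "finite ?S" by (simp add: verts)
    have r: "r \<in> ?S" unfolding r_def using fin i by (intro Min_in) auto
    have r_le: "r \<le> j" if "j \<in> ?S" for j using fin that by (simp add: r_def)
    show "connected_in (parcs T) ?S"
      unfolding T_def
    proof (rule connected_in_parent_tree[where r = r])
      fix j assume j: "j \<in> {t \<in> pverts (parent_tree ?n p). v \<in> bs ! t}" "j \<noteq> r"
      then have jS: "j \<in> ?S" by (simp add: T_def)
      then have "r < j" using r_le j by force
      then have "bs ! r \<in> set (take j bs)" using jS verts by (auto simp: in_set_conv_nth)
      then have "v \<in> \<Union> (set (take j bs))" using r by blast
      then have "v \<in> bs ! p j" using sep[of j] \<open>r < j\<close> jS verts by auto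
      then show "0 < j \<and> p j \<in> {t \<in> pverts (parent_tree ?n p). v \<in> bs ! t}"
        using \<open>r < j\<close> p[of j] jS verts by (simp add: T_def)
    qed (use p r verts in \<open>auto simp: T_def\<close>)
  qed
  moreover have "(\<Union>t\<in>pverts T. bs ! t) = pverts G" using union bags verts by simp
  moreover have "\<forall>(u, v)\<in>parcs G. \<exists>t\<in>pverts T. {u, v} \<subseteq> bs ! t"
    using edges bags verts by fastforce
  ultimately have "tree_decomposition G T (\<lambda>i. bs ! i)"
    using tree by (simp add: tree_decomposition_def)
  then show ?thesis using verts by blast
qed

section \<open>Independence number of vertex sets\<close>

context pair_graph begin

definition stable :: "'a set \<Rightarrow> bool" where
  "stable I \<longleftrightarrow> (\<forall>u\<in>I. \<forall>v\<in>I. (u, v) \<notin> parcs G)"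

lemma sym_parcs: "sym (parcs G)"
  by (rule symI) (rule arcs_symmetric)

lemma alpha_conv: "alpha G X = Max {card I | I. I \<subseteq> X \<and> stable I}"
proof -
  have "independent_set (with_proj G \<restriction> X) I \<longleftrightarrow> I \<subseteq> X \<and> stable I" for I
  proof -
    have "arcs_ends (with_proj G \<restriction> X) = parcs G \<inter> X \<times> X"
      by (force simp add: Digraph.arcs_ends_def arc_to_ends_def)
    then show ?thesis
      unfolding independent_set_def stable_def induce_subgraph_verts by blast
  qed
  then show ?thesis by (simp add: alpha_def)
qed

lemma finite_stable_cards: "finite X \<Longrightarrow> finite {card I | I. I \<subseteq> X \<and> stable I}"
  by simp

lemma card_le_alpha: "\<lbrakk>finite X; I \<subseteq> X; stable I\<rbrakk> \<Longrightarrow> card I \<le> alpha G X"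
  unfolding alpha_conv by (rule Max_ge) auto

lemma alpha_attained:
  assumes "finite X"
  obtains I where "I \<subseteq> X" "stable I" "card I = alpha G X"
proof -
  have "stable {}" by (simp add: stable_def)
  then have "alpha G X \<in> {card I | I. I \<subseteq> X \<and> stable I}"
    unfolding alpha_conv using finite_stable_cards[OF assms] by (intro Max_in) blast+
  then show ?thesis using that by force
qed

lemma alpha_mono:
  assumes "finite Y" "X \<subseteq> Y" shows "alpha G X \<le> alpha G Y"
proof -
  obtain I where "I \<subseteq> X" "stable I" "card I = alpha G X"
    using alpha_attained finite_subset assms by metis
  then show ?thesis using card_le_alpha[of Y I] assms by simp
qed

lemma alpha_le_card: "finite X \<Longrightarrow> alpha G X \<le> card X"
  by (metis alpha_attained card_mono)

lemma alpha_empty [simp]: "alpha G {} = 0"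
  using alpha_le_card[of "{}"] by simp

lemma alpha_Un_le:
  assumes "finite X" "finite Y" shows "alpha G (X \<union> Y) \<le> alpha G X + alpha G Y"
proof -
  obtain I where I: "I \<subseteq> X \<union> Y" "stable I" "card I = alpha G (X \<union> Y)"
    using alpha_attained[of "X \<union> Y"] assms by auto
  have "stable (I \<inter> X)" "stable (I \<inter> Y)" using I by (auto simp: stable_def)
  then have "card (I \<inter> X) \<le> alpha G X" "card (I \<inter> Y) \<le> alpha G Y"
    using assms by (auto intro: card_le_alpha)
  moreover have "I = (I \<inter> X) \<union> (I \<inter> Y)" using I by blast
  then have "card I \<le> card (I \<inter> X) + card (I \<inter> Y)" by (metis card_Un_le)
  ultimately show ?thesis using I by simp
qed

lemma alpha_insert_le: "finite X \<Longrightarrow> alpha G (insert v X) \<le> Suc (alpha G X)"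
  using alpha_Un_le[of "{v}" X] alpha_le_card[of "{v}"] by simp

lemma alpha_add_le_Un:
  assumes "finite X" "finite Y" "X \<inter> Y = {}"
    and anticomplete: "\<And>x y. \<lbrakk>x \<in> X; y \<in> Y\<rbrakk> \<Longrightarrow> (x, y) \<notin> parcs G"
  shows "alpha G X + alpha G Y \<le> alpha G (X \<union> Y)"
proof -
  obtain I where I: "I \<subseteq> X" "stable I" "card I = alpha G X"
    using alpha_attained assms by metis
  obtain J where J: "J \<subseteq> Y" "stable J" "card J = alpha G Y"
    using alpha_attained assms by metis
  have "stable (I \<union> J)"
    using I J anticomplete arcs_symmetric unfolding stable_def by blast
  then have "card (I \<union> J) \<le> alpha G (X \<union> Y)"
    using I J assms by (intro card_le_alpha) auto
  moreover have "card (I \<union> J) = card I + card J"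
    using I J assms by (intro card_Un_disjoint) (auto dest: finite_subset)
  ultimately show ?thesis using I J by simp
qed

end

section \<open>Components\<close>

definition component :: "'v rel \<Rightarrow> 'v set \<Rightarrow> 'v \<Rightarrow> 'v set" where
  "component E S x = {y. (x, y) \<in> rtrancl_on S E}"

lemma component_subset: "component E S x \<subseteq> S"
  by (auto simp: component_def dest: in_rtrancl_on_in_F)

lemma component_self: "x \<in> S \<Longrightarrow> x \<in> component E S x"
  by (simp add: component_def)

lemma component_closed: "\<lbrakk>y \<in> component E S x; (y, z) \<in> E; z \<in> S\<rbrakk> \<Longrightarrow> z \<in> component E S x"
  by (auto simp: component_def intro: rtrancl_on_into_rtrancl_on)

lemma component_eq:
  assumes "sym E" "z \<in> component E S x" "z \<in> component E S y"
  shows "component E S x = component E S y"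
proof -
  have sym: "(b, a) \<in> rtrancl_on S E" if "(a, b) \<in> rtrancl_on S E" for a b
    using rtrancl_on_sym[OF \<open>sym E\<close>, of S] that by (rule symD)
  have xz: "(x, z) \<in> rtrancl_on S E" and yz: "(y, z) \<in> rtrancl_on S E"
    using assms by (simp_all add: component_def)
  have xy: "(x, y) \<in> rtrancl_on S E"
    using xz sym[OF yz] by (rule rtrancl_on_trans)
  show ?thesis
    unfolding component_def using rtrancl_on_trans[OF xy] rtrancl_on_trans[OF sym[OF xy]] by blast
qed

lemma connected_in_component:
  assumes "sym E" shows "connected_in E (component E S x)"
proof -
  let ?C = "component E S x"
  have root: "(x, y) \<in> rtrancl_on ?C E" if "y \<in> ?C" for y
  proof -
    have "(x, y) \<in> rtrancl_on S E" using that by (simp add: component_def)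
    then show ?thesis
    proof (induct rule: rtrancl_on_induct)
      case base then show ?case by (simp add: component_self)
    next
      case (step y z)
      then have "z \<in> ?C" by (auto simp: component_def intro: rtrancl_on_into_rtrancl_on)
      then show ?case using step by (auto intro: rtrancl_on_into_rtrancl_on)
    qed
  qed
  show ?thesis
    unfolding connected_in_def using root rtrancl_on_sym[OF assms, of ?C]
    by (meson rtrancl_on_trans symD)
qed

section \<open>Brambles and tree decompositions\<close>

context pair_graph begin

lemma connected_set_iff:
  "connected_set G X \<longleftrightarrow> X \<subseteq> pverts G \<and> X \<noteq> {} \<and> connected_in (parcs G) X"
  by (auto simp: connected_set_def connected_induce_iff[OF sym_parcs])

lemma finite_cover_alphas: "finite {alpha G X | X. bramble_cover G \<B> X}"
proof -
  have "{alpha G X | X. bramble_cover G \<B> X} \<subseteq> alpha G ` Pow (pverts G)"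
    by (auto simp: bramble_cover_def)
  then show ?thesis using finite_subset pair_finite_verts by blast
qed

lemma alpha_order_le: "bramble_cover G \<B> X \<Longrightarrow> alpha_order G \<B> \<le> alpha G X"
  unfolding alpha_order_def using finite_cover_alphas by (intro Min_le) auto

lemma le_alpha_order:
  assumes "strong_bramble G \<B>" and "\<And>X. bramble_cover G \<B> X \<Longrightarrow> k \<le> alpha G X"
  shows "k \<le> alpha_order G \<B>"
proof -
  have "bramble_cover G \<B> (pverts G)"
    using assms(1) by (auto simp: bramble_cover_def strong_bramble_def connected_set_iff)
  then have "{alpha G X | X. bramble_cover G \<B> X} \<noteq> {}" by blast
  then show ?thesis
    unfolding alpha_order_def using finite_cover_alphas assms(2) by (subst Min_ge_iff) auto
qed

lemma connected_in_nodes_of_vertex: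
  assumes dec: "tree_decomposition G T \<beta>" and v: "v \<in> pverts G"
  shows "connected_in (parcs T) {t \<in> pverts T. v \<in> \<beta> t}"
proof -
  interpret T: pair_graph T using dec by (simp add: tree_decomposition_def undirected_tree_iff)
  have "undirected_tree (with_proj T \<restriction> {t \<in> pverts T. v \<in> \<beta> t})"
    using assms by (simp add: tree_decomposition_def)
  then show ?thesis
    unfolding undirected_tree_def connected_induce_iff[OF T.sym_parcs] by blast
qed

text \<open>
  Following a path in \<open>B\<close>, the nodes of its first vertex are joined to those of its last:
  consecutive vertices share a bag, and the nodes of each single vertex are connected.
\<close>

lemma connected_in_nodes_of_set:
  assumes dec: "tree_decomposition G T \<beta>" and B: "connected_set G B"
  shows "connected_in (parcs T) {t \<in> pverts T. B \<inter> \<beta> t \<noteq> {}}"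
  unfolding connected_in_def
proof (intro ballI)
  let ?S = "{t \<in> pverts T. B \<inter> \<beta> t \<noteq> {}}"
  fix s t assume s: "s \<in> ?S" and t: "t \<in> ?S"
  obtain x where x: "x \<in> B" "x \<in> \<beta> s" using s by blast
  obtain y where y: "y \<in> B" "y \<in> \<beta> t" using t by blast
  have same: "(a, b) \<in> rtrancl_on ?S (parcs T)"
    if "z \<in> B" "a \<in> pverts T" "b \<in> pverts T" "z \<in> \<beta> a" "z \<in> \<beta> b" for z a b
  proof -
    have "z \<in> pverts G" using B that by (auto simp: connected_set_def)
    then have "(a, b) \<in> rtrancl_on {t \<in> pverts T. z \<in> \<beta> t} (parcs T)"
      using connected_in_nodes_of_vertex[OF dec] that by (auto simp: connected_in_def)
    then show ?thesis
      by (rule rtrancl_on_mono[rotated 2]) (use that in auto)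
  qed
  have "(x, y) \<in> rtrancl_on B (parcs G)"
    using B x y by (simp add: connected_set_iff connected_in_def)
  then have "\<forall>t\<in>pverts T. y \<in> \<beta> t \<longrightarrow> (s, t) \<in> rtrancl_on ?S (parcs T)"
  proof (induct rule: rtrancl_on_induct)
    case base
    then show ?case using same[of x s] s x by blast
  next
    case (step y z)
    obtain r where r: "r \<in> pverts T" "y \<in> \<beta> r" "z \<in> \<beta> r"
      using dec step(2) by (fastforce simp: tree_decomposition_def)
    have "(s, r) \<in> rtrancl_on ?S (parcs T)" using step r by blast
    then show ?case
      using same[of z r] step(4) r by (blast intro: rtrancl_on_trans)
  qed
  then show "(s, t) \<in> rtrancl_on ?S (parcs T)" using t y by blast
qed

theorem strong_bramble_covered_by_bag:
  assumes dec: "tree_decomposition G T \<beta>" and \<B>: "strong_bramble G \<B>"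
  shows "\<exists>t\<in>pverts T. bramble_cover G \<B> (\<beta> t)"
proof -
  interpret T: pair_graph T using dec by (simp add: tree_decomposition_def undirected_tree_iff)
  let ?S = "\<lambda>B. {t \<in> pverts T. B \<inter> \<beta> t \<noteq> {}}"
  have ne: "pverts T \<noteq> {}" and acyclic: "\<nexists>c. vertex_cycle (parcs T) c"
    using dec by (auto simp: tree_decomposition_def undirected_tree_iff)
  have irrefl: "irrefl (parcs T)" by (auto intro!: irreflI dest: T.no_loops')
  have bags: "(\<Union>t\<in>pverts T. \<beta> t) = pverts G" using dec by (simp add: tree_decomposition_def)
  have "\<exists>t\<in>pverts T. \<forall>S\<in>?S ` \<B>. t \<in> S"
  proof (rule acyclic_helly[OF T.pair_finite_verts ne T.sym_parcs irrefl acyclic])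
    fix S assume "S \<in> ?S ` \<B>"
    then obtain B where "B \<in> \<B>" "S = ?S B" by blast
    then show "S \<subseteq> pverts T \<and> connected_in (parcs T) S"
      using connected_in_nodes_of_set[OF dec, of B] \<B> by (auto simp: strong_bramble_def)
  next
    fix S S' assume "S \<in> ?S ` \<B>" "S' \<in> ?S ` \<B>"
    then obtain B C where BC: "B \<in> \<B>" "C \<in> \<B>" "S = ?S B" "S' = ?S C" by blast
    then have "B \<inter> C \<noteq> {}" using \<B> by (auto simp: strong_bramble_def)
    then obtain v where v: "v \<in> B" "v \<in> C" by blast
    have "v \<in> pverts G" using \<B> BC v by (auto simp: strong_bramble_def connected_set_def)
    then obtain t where "t \<in> pverts T" "v \<in> \<beta> t" using bags by blast
    then show "S \<inter> S' \<noteq> {}" using BC v by blast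
  qed
  then obtain t where t: "t \<in> pverts T" "\<forall>B\<in>\<B>. B \<inter> \<beta> t \<noteq> {}" by auto
  moreover have "\<beta> t \<subseteq> pverts G" using bags t by blast
  ultimately show ?thesis by (auto simp: bramble_cover_def)
qed

corollary alpha_order_le_alpha_width:
  assumes dec: "tree_decomposition G T \<beta>" and "strong_bramble G \<B>"
  shows "alpha_order G \<B> \<le> alpha_width G T \<beta>"
proof -
  obtain t where t: "t \<in> pverts T" "bramble_cover G \<B> (\<beta> t)"
    using strong_bramble_covered_by_bag[OF assms] by blast
  interpret T: pair_graph T using dec by (simp add: tree_decomposition_def undirected_tree_iff)
  have "alpha G (\<beta> t) \<le> alpha_width G T \<beta>"
    unfolding alpha_width_def using T.pair_finite_verts t by (intro Max_ge) auto
  then show ?thesis using alpha_order_le[OF t(2)] by linarith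
qed

section \<open>Separators from the absence of brambles\<close>

text \<open>
  The bramble consists of all large components. If \<open>B\<close> and \<open>D\<close>, components of \<open>G - X\<close> and \<open>G - Y\<close>,
  were disjoint members, there would be no edges between \<open>B - Y\<close> and \<open>D\<close>. Then independent sets in
  \<open>W \<inter> B - Y\<close> and \<open>W \<inter> D\<close> could be united, and \<open>W\<close> would have independence number at least
  \<open>(2k - 1) - (k - 1) + (2k - 1) = 3k - 1\<close>. A set \<open>X\<close> of independence number less than \<open>k\<close> is
  not a cover, since it is disjoint from every component of \<open>G - X\<close>, in particular from a large one.
\<close>

lemma strong_bramble_of_large_components:
  assumes W: "W \<subseteq> pverts G" "alpha G W + 2 \<le> 3 * k"
    and large: "\<And>X. \<lbrakk>X \<subseteq> pverts G; alpha G X < k\<rbrakk> \<Longrightarrow>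
      \<exists>x\<in>pverts G - X. 2 * k \<le> alpha G (W \<inter> component (parcs G) (pverts G - X) x) + 1"
  shows "\<exists>\<B>. strong_bramble G \<B> \<and> k \<le> alpha_order G \<B>"
proof -
  let ?C = "\<lambda>X. component (parcs G) (pverts G - X)"
  define \<B> where "\<B> = {?C X x | X x. X \<subseteq> pverts G \<and> alpha G X < k \<and> x \<in> pverts G - X \<and>
    2 * k \<le> alpha G (W \<inter> ?C X x) + 1}"
  have fin: "finite S" if "S \<subseteq> pverts G" for S
    using that pair_finite_verts by (rule finite_subset)
  have conn: "connected_set G B" if "B \<in> \<B>" for B
  proof -
    obtain X x where B: "B = ?C X x" "x \<in> pverts G - X" using \<open>B \<in> \<B>\<close> by (auto simp: \<B>_def)
    then show ?thesis
      using component_subset[of "parcs G" "pverts G - X" x] component_self[OF B(2), of "parcs G"]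
        connected_in_component[OF sym_parcs] by (auto simp: connected_set_iff)
  qed
  have meet: "B \<inter> D \<noteq> {}" if BD: "B \<in> \<B>" "D \<in> \<B>" for B D
  proof
    assume disj: "B \<inter> D = {}"
    obtain X x where B: "B = ?C X x" "2 * k \<le> alpha G (W \<inter> B) + 1"
      using BD by (auto simp: \<B>_def)
    obtain Y y where D: "D = ?C Y y" "Y \<subseteq> pverts G" "alpha G Y < k"
        "2 * k \<le> alpha G (W \<inter> D) + 1"
      using BD by (auto simp: \<B>_def)
    have sub: "B \<subseteq> pverts G" "D \<subseteq> pverts G"
      using conn[OF BD(1)] conn[OF BD(2)] by (auto simp: connected_set_def)
    have "(a, b) \<notin> parcs G" if "a \<in> W \<inter> B - Y" "b \<in> W \<inter> D" for a b
    proof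
      assume "(a, b) \<in> parcs G"
      then have "(b, a) \<in> parcs G" by (rule arcs_symmetric)
      then have "a \<in> D"
        using component_closed[of b "parcs G" "pverts G - Y" y a] that sub D by auto
      then show False using disj that by blast
    qed
    then have "alpha G (W \<inter> B - Y) + alpha G (W \<inter> D) \<le> alpha G ((W \<inter> B - Y) \<union> (W \<inter> D))"
      using disj W fin by (intro alpha_add_le_Un) auto
    also have "\<dots> \<le> alpha G W" using W fin by (intro alpha_mono) auto
    finally have "alpha G (W \<inter> B - Y) + alpha G (W \<inter> D) \<le> alpha G W" .
    moreover have "alpha G (W \<inter> B) \<le> alpha G ((W \<inter> B - Y) \<union> Y)"
      using W D fin by (intro alpha_mono) auto
    moreover have "alpha G ((W \<inter> B - Y) \<union> Y) \<le> alpha G (W \<inter> B - Y) + alpha G Y"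
      using W D fin by (intro alpha_Un_le) auto
    ultimately show False using B D W by linarith
  qed
  have bramble: "strong_bramble G \<B>" using conn meet by (simp add: strong_bramble_def)
  moreover have "k \<le> alpha_order G \<B>"
  proof (rule le_alpha_order[OF bramble], rule ccontr)
    fix X assume X: "bramble_cover G \<B> X" "\<not> k \<le> alpha G X"
    then have XV: "X \<subseteq> pverts G" by (simp add: bramble_cover_def)
    then obtain x where "x \<in> pverts G - X" "2 * k \<le> alpha G (W \<inter> ?C X x) + 1"
      using large[OF XV] X by auto
    then have "?C X x \<in> \<B>" unfolding \<B>_def mem_Collect_eq using X(2) XV not_le by blast
    then have "?C X x \<inter> X \<noteq> {}" using X by (simp add: bramble_cover_def)
    then show False using component_subset[of "parcs G" "pverts G - X" x] by blast
  qed
  ultimately show ?thesis by blast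
qed

section \<open>Tree decompositions from separators\<close>

definition covers_edges :: "'a set list \<Rightarrow> 'a set \<Rightarrow> bool" where
  "covers_edges bs S \<longleftrightarrow> (\<forall>u\<in>S. \<forall>v\<in>S. (u, v) \<in> parcs G \<longrightarrow> (\<exists>b\<in>set bs. u \<in> b \<and> v \<in> b))"

lemma covers_edges_mono: "\<lbrakk>covers_edges bs S; set bs \<subseteq> set cs\<rbrakk> \<Longrightarrow> covers_edges cs S"
  unfolding covers_edges_def by (meson subsetD)

text \<open>
  Here \<open>R\<close> becomes the root bag, and the decompositions of the parts are attached to it below. The
  part \<open>i\<close> has the private vertices \<open>A i\<close> and shares with the root only the vertices \<open>N i\<close>. These
  lie in both root bags, as \<open>running_intersection_append\<close> requires.
\<close>

lemma glue_bags:
  assumes "finite I" and R: "alpha G R \<le> w"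
    and parts: "\<And>i. i \<in> I \<Longrightarrow> \<exists>bs. running_intersection bs \<and> N i \<subseteq> hd bs \<and>
      \<Union> (set bs) = N i \<union> A i \<and> (\<forall>b\<in>set bs. alpha G b \<le> w) \<and> covers_edges bs (N i \<union> A i)"
    and N: "\<And>i. i \<in> I \<Longrightarrow> N i \<subseteq> R"
    and A: "\<And>i. i \<in> I \<Longrightarrow> A i \<inter> R = {}"
    and disj: "\<And>i j. \<lbrakk>i \<in> I; j \<in> I; i \<noteq> j\<rbrakk> \<Longrightarrow> A i \<inter> A j = {}"
  shows "\<exists>bs. running_intersection bs \<and> hd bs = R \<and> \<Union> (set bs) = R \<union> (\<Union>i\<in>I. A i) \<and>
    (\<forall>b\<in>set bs. alpha G b \<le> w) \<and> (\<forall>i\<in>I. covers_edges bs (N i \<union> A i))"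
  using assms(1,3-6)
proof (induction I rule: finite_induct)
  case empty
  have "running_intersection [R]" by (auto simp: running_intersection_def)
  then show ?case using R by (intro exI[of _ "[R]"]) auto
next
  case (insert i I)
  have "\<exists>bs. running_intersection bs \<and> hd bs = R \<and> \<Union> (set bs) = R \<union> (\<Union>i\<in>I. A i) \<and>
      (\<forall>b\<in>set bs. alpha G b \<le> w) \<and> (\<forall>i\<in>I. covers_edges bs (N i \<union> A i))"
    by (rule insert.IH) (use insert.prems in auto)
  then obtain bs where bs: "running_intersection bs" "hd bs = R"
      "\<Union> (set bs) = R \<union> (\<Union>i\<in>I. A i)" "\<forall>b\<in>set bs. alpha G b \<le> w"
      "\<forall>i\<in>I. covers_edges bs (N i \<union> A i)" by blast
  obtain cs where cs: "running_intersection cs" "N i \<subseteq> hd cs" "\<Union> (set cs) = N i \<union> A i"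
      "\<forall>b\<in>set cs. alpha G b \<le> w" "covers_edges cs (N i \<union> A i)"
    using insert.prems(1)[of i] by blast
  have "bs \<noteq> []" using bs(1) by (simp add: running_intersection_def)
  have "A i \<inter> A j = {}" if "j \<in> I" for j
    using that insert.hyps(2) insert.prems(4)[of i j] by blast
  then have "A i \<inter> \<Union> (set bs) = {}" using bs(3) insert.prems(3)[of i] by blast
  then have "\<Union> (set bs) \<inter> \<Union> (set cs) \<subseteq> hd bs \<inter> hd cs"
    using bs cs insert.prems(2)[of i] by blast
  then have "running_intersection (bs @ cs)" using bs cs by (intro running_intersection_append)
  moreover have "hd (bs @ cs) = R" using bs \<open>bs \<noteq> []\<close> by simp
  moreover have "\<Union> (set (bs @ cs)) = R \<union> (\<Union>i\<in>insert i I. A i)"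
    using bs(3) cs(3) insert.prems(2)[of i] by auto
  moreover have "\<forall>b\<in>set (bs @ cs). alpha G b \<le> w" using bs cs by auto
  moreover have "\<forall>j\<in>insert i I. covers_edges (bs @ cs) (N j \<union> A j)"
    using bs(5) covers_edges_mono[OF cs(5)] covers_edges_mono[of bs _ "bs @ cs"] by auto
  ultimately show ?case by blast
qed

text \<open>
  In this induction on the size of \<open>U\<close>, the part of the decomposition for a component \<open>C\<close> of
  \<open>G - X\<close> that meets \<open>U\<close> has private vertices \<open>C \<inter> U\<close> and shares
  \<open>N C = (X \<inter> (W \<union> U)) \<union> (W \<inter> C)\<close> with the root bag. The induction hypothesis is applied after
  moving one vertex of \<open>C \<inter> U\<close> into the boundary \<open>N C\<close>.
\<close>

lemma decomposition_of_separators: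
  assumes sep: "\<And>W. \<lbrakk>W \<subseteq> pverts G; alpha G W + 2 \<le> 3 * k\<rbrakk> \<Longrightarrow>
      \<exists>X\<subseteq>pverts G. alpha G X < k \<and>
        (\<forall>x\<in>pverts G - X. alpha G (W \<inter> component (parcs G) (pverts G - X) x) + 2 \<le> 2 * k)"
    and "W \<subseteq> pverts G" "U \<subseteq> pverts G" "W \<inter> U = {}" "alpha G W + 2 \<le> 3 * k"
    and "\<And>u v. \<lbrakk>u \<in> U; (u, v) \<in> parcs G\<rbrakk> \<Longrightarrow> v \<in> W \<union> U"
  shows "\<exists>bs. running_intersection bs \<and> W \<subseteq> hd bs \<and> \<Union> (set bs) = W \<union> U \<and>
    (\<forall>b\<in>set bs. alpha G b \<le> 4 * k - 3) \<and> covers_edges bs (W \<union> U)"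
  using assms(2-6)
proof (induction "card U" arbitrary: U W rule: less_induct)
  case less
  note W = less.prems(1,4) and U = less.prems(2) and WU = less.prems(3) and nbrs = less.prems(5)
  have fin: "finite S" if "S \<subseteq> pverts G" for S
    using that pair_finite_verts by (rule finite_subset)
  obtain X where X: "X \<subseteq> pverts G" "alpha G X < k"
    and small: "\<And>x. x \<in> pverts G - X \<Longrightarrow>
      alpha G (W \<inter> component (parcs G) (pverts G - X) x) + 2 \<le> 2 * k"
    using sep[OF W] by blast
  define R where "R = W \<union> (X \<inter> U)"
  define \<C> where "\<C> = component (parcs G) (pverts G - X) ` (U - X)"
  define N where "N C = (X \<inter> (W \<union> U)) \<union> (W \<inter> C)" for C
  have C_sub: "C \<subseteq> pverts G - X" if "C \<in> \<C>" for C
    using that component_subset by (fastforce simp: \<C>_def)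
  have C_closed: "b \<in> C" if "C \<in> \<C>" "a \<in> C" "(a, b) \<in> parcs G" "b \<notin> X" for C a b
    using that component_closed[of a "parcs G" "pverts G - X" _ b] in_arcsD2
    by (auto simp: \<C>_def)
  have disj: "C \<inter> D = {}" if CD: "C \<in> \<C>" "D \<in> \<C>" "C \<noteq> D" for C D
  proof (rule ccontr)
    assume "C \<inter> D \<noteq> {}"
    then obtain z where "z \<in> C" "z \<in> D" by blast
    moreover obtain x y where "C = component (parcs G) (pverts G - X) x"
      "D = component (parcs G) (pverts G - X) y" using CD by (auto simp: \<C>_def)
    ultimately show False using component_eq[OF sym_parcs] CD(3) by metis
  qed
  have "alpha G R \<le> alpha G (W \<union> X)"
    using W X fin by (intro alpha_mono) (auto simp: R_def)
  also have "\<dots> \<le> alpha G W + alpha G X" using W X fin by (intro alpha_Un_le) auto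
  finally have R: "alpha G R \<le> 4 * k - 3" using W X by linarith
  have parts: "\<exists>bs. running_intersection bs \<and> N C \<subseteq> hd bs \<and> \<Union> (set bs) = N C \<union> (C \<inter> U) \<and>
      (\<forall>b\<in>set bs. alpha G b \<le> 4 * k - 3) \<and> covers_edges bs (N C \<union> (C \<inter> U))" if C: "C \<in> \<C>" for C
  proof -
    obtain v where v: "v \<in> U - X" "C = component (parcs G) (pverts G - X) v"
      using C by (auto simp: \<C>_def)
    have vC: "v \<in> C" using v U component_self[of v "pverts G - X" "parcs G"] by auto
    have NV: "N C \<subseteq> pverts G" using W U by (auto simp: N_def)
    have "alpha G (N C) \<le> alpha G (X \<union> (W \<inter> C))"
      using W X fin by (intro alpha_mono) (auto simp: N_def)
    also have "\<dots> \<le> alpha G X + alpha G (W \<inter> C)" using W X fin by (intro alpha_Un_le) auto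
    finally have aN: "alpha G (insert v (N C)) + 2 \<le> 3 * k"
      using small[of v] v U X alpha_insert_le[of "N C" v] fin[OF NV] by auto
    have "card (C \<inter> U - {v}) < card U"
      using v vC fin[OF U] by (intro psubset_card_mono) auto
    then have "\<exists>bs. running_intersection bs \<and> insert v (N C) \<subseteq> hd bs \<and>
        \<Union> (set bs) = insert v (N C) \<union> (C \<inter> U - {v}) \<and>
        (\<forall>b\<in>set bs. alpha G b \<le> 4 * k - 3) \<and>
        covers_edges bs (insert v (N C) \<union> (C \<inter> U - {v}))"
    proof (rule less.hyps)
      show "insert v (N C) \<subseteq> pverts G" using NV v U by auto
      show "C \<inter> U - {v} \<subseteq> pverts G" using U by blast
      show "insert v (N C) \<inter> (C \<inter> U - {v}) = {}"
        using WU C_sub[OF C] by (auto simp: N_def)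
      show "alpha G (insert v (N C)) + 2 \<le> 3 * k" by (rule aN)
      fix a b assume a: "a \<in> C \<inter> U - {v}" and ab: "(a, b) \<in> parcs G"
      then have "b \<in> W \<union> U" using nbrs by blast
      moreover have "b \<in> X \<or> b \<in> C" using C_closed[OF C _ ab] a by blast
      ultimately show "b \<in> insert v (N C) \<union> (C \<inter> U - {v})" by (auto simp: N_def)
    qed
    moreover have "insert v (N C) \<union> (C \<inter> U - {v}) = N C \<union> (C \<inter> U)" using v vC by auto
    ultimately show ?thesis by auto
  qed
  have "\<exists>bs. running_intersection bs \<and> hd bs = R \<and> \<Union> (set bs) = R \<union> (\<Union>C\<in>\<C>. C \<inter> U) \<and>
      (\<forall>b\<in>set bs. alpha G b \<le> 4 * k - 3) \<and> (\<forall>C\<in>\<C>. covers_edges bs (N C \<union> (C \<inter> U)))"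
  proof (rule glue_bags[OF _ R parts])
    show "finite \<C>" using fin[OF U] by (simp add: \<C>_def)
    show "N C \<subseteq> R" if "C \<in> \<C>" for C by (auto simp: N_def R_def)
    show "(C \<inter> U) \<inter> R = {}" if "C \<in> \<C>" for C using C_sub[OF that] WU by (auto simp: R_def)
    show "(C \<inter> U) \<inter> (D \<inter> U) = {}" if "C \<in> \<C>" "D \<in> \<C>" "C \<noteq> D" for C D
      using disj[OF that] by blast
  qed
  then obtain bs where bs: "running_intersection bs" "hd bs = R"
      "\<Union> (set bs) = R \<union> (\<Union>C\<in>\<C>. C \<inter> U)" "\<forall>b\<in>set bs. alpha G b \<le> 4 * k - 3"
      "\<And>C. C \<in> \<C> \<Longrightarrow> covers_edges bs (N C \<union> (C \<inter> U))" by blast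
  have own: "\<exists>C\<in>\<C>. u \<in> C" if "u \<in> U - X" for u
    using that U component_self[of u "pverts G - X" "parcs G"] by (auto simp: \<C>_def)
  have "\<Union> (set bs) = W \<union> U" using bs(3) own by (auto simp: R_def)
  moreover have edge: "\<exists>b\<in>set bs. u \<in> b \<and> v \<in> b"
    if uv: "u \<in> U - X" "v \<in> W \<union> U" "(u, v) \<in> parcs G" for u v
  proof -
    obtain C where C: "C \<in> \<C>" "u \<in> C" using own uv by blast
    have "v \<in> X \<or> v \<in> C" using C_closed[OF C uv(3)] by blast
    then have "u \<in> N C \<union> (C \<inter> U)" "v \<in> N C \<union> (C \<inter> U)" using C uv by (auto simp: N_def)
    then show ?thesis using bs(5)[OF C(1)] uv(3) unfolding covers_edges_def by blast
  qed
  have "covers_edges bs (W \<union> U)"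
    unfolding covers_edges_def
  proof (intro ballI impI)
    fix u v assume uv: "u \<in> W \<union> U" "v \<in> W \<union> U" "(u, v) \<in> parcs G"
    have root: "R \<in> set bs" using bs(1,2) by (auto simp: running_intersection_def)
    consider "u \<in> U - X" | "v \<in> U - X" | "u \<in> R" "v \<in> R"
      using uv by (auto simp: R_def)
    then show "\<exists>b\<in>set bs. u \<in> b \<and> v \<in> b"
    proof cases
      case 1 then show ?thesis using edge uv by blast
    next
      case 2 then show ?thesis using edge[OF _ uv(1) arcs_symmetric[OF uv(3)]] by blast
    next
      case 3 then show ?thesis using root by blast
    qed
  qed
  moreover have "W \<subseteq> hd bs" using bs(2) by (simp add: R_def)
  ultimately show ?case using bs by blast
qed

lemma tree_independence_number_le:
  assumes rip: "running_intersection bs" "\<Union> (set bs) = pverts G" "covers_edges bs (pverts G)"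
    and w: "\<And>b. b \<in> set bs \<Longrightarrow> alpha G b \<le> w"
  shows "tree_independence_number G \<le> w"
proof -
  have "\<exists>b\<in>set bs. u \<in> b \<and> v \<in> b" if "(u, v) \<in> parcs G" for u v
    using rip(3) that in_arcsD1 in_arcsD2 by (simp add: covers_edges_def)
  then obtain T :: "nat pair_pre_digraph"
    where T: "tree_decomposition G T (\<lambda>i. bs ! i)" "pverts T = {..<length bs}"
    using tree_decomposition_of_bags[OF rip(1,2)] by blast
  have "bs \<noteq> []" using rip(1) by (simp add: running_intersection_def)
  have "tree_independence_number G \<le> alpha_width G T (\<lambda>i. bs ! i)"
    unfolding tree_independence_number_def using T by (intro Least_le) blast
  also have "\<dots> \<le> w"
    unfolding alpha_width_def using T(2) w \<open>bs \<noteq> []\<close> by (intro Max.boundedI) auto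
  finally show ?thesis .
qed

lemma tree_independence_number_attained:
  obtains T :: "nat pair_pre_digraph" and \<beta>
  where "tree_decomposition G T \<beta>" "tree_independence_number G = alpha_width G T \<beta>"
proof -
  have "\<exists>T :: nat pair_pre_digraph. tree_decomposition G T (\<lambda>i. [pverts G] ! i) \<and>
      pverts T = {..<length [pverts G]}"
    using in_arcsD1 in_arcsD2
    by (intro tree_decomposition_of_bags) (force simp: running_intersection_def)+
  then have "\<exists>w (T :: nat pair_pre_digraph) \<beta>. tree_decomposition G T \<beta> \<and> w = alpha_width G T \<beta>"
    by blast
  from LeastI_ex[OF this] show ?thesis
    using that unfolding tree_independence_number_def by blast
qed

theorem alpha_order_le_tree_independence_number:
  assumes "strong_bramble G \<B>"
  shows "alpha_order G \<B> \<le> tree_independence_number G"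
  using tree_independence_number_attained alpha_order_le_alpha_width[OF _ assms] by metis

theorem strong_bramble_if_large_tree_independence_number:
  assumes "0 < k" "4 * k - 2 \<le> tree_independence_number G"
  shows "\<exists>\<B>. strong_bramble G \<B> \<and> k \<le> alpha_order G \<B>"
proof (rule ccontr)
  assume none: "\<not> ?thesis"
  have "\<exists>X\<subseteq>pverts G. alpha G X < k \<and>
      (\<forall>x\<in>pverts G - X. alpha G (W \<inter> component (parcs G) (pverts G - X) x) + 2 \<le> 2 * k)"
    if W: "W \<subseteq> pverts G" "alpha G W + 2 \<le> 3 * k" for W
  proof (rule ccontr)
    assume no: "\<not> ?thesis"
    have "\<exists>x\<in>pverts G - X. 2 * k \<le> alpha G (W \<inter> component (parcs G) (pverts G - X) x) + 1"
      if X: "X \<subseteq> pverts G" "alpha G X < k" for X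
    proof -
      obtain x where "x \<in> pverts G - X"
        "\<not> alpha G (W \<inter> component (parcs G) (pverts G - X) x) + 2 \<le> 2 * k"
        using no X by blast
      then show ?thesis by (intro bexI[of _ x]) linarith+
    qed
    then show False using strong_bramble_of_large_components[OF W] none by blast
  qed
  then have "\<exists>bs. running_intersection bs \<and> {} \<subseteq> hd bs \<and> \<Union> (set bs) = {} \<union> pverts G \<and>
      (\<forall>b\<in>set bs. alpha G b \<le> 4 * k - 3) \<and> covers_edges bs ({} \<union> pverts G)"
    using assms(1) in_arcsD2 by (intro decomposition_of_separators) auto
  then have "tree_independence_number G \<le> 4 * k - 3"
    using tree_independence_number_le by auto
  then show False using assms by linarith
qed

end

theorem theorem1p3:
  fixes G :: "'a pair_pre_digraph" and k :: nat
  assumes "pair_graph G" and "k > 0"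
  shows "((\<exists>\<B>. strong_bramble G \<B> \<and> alpha_order G \<B> = k) \<longrightarrow> tree_independence_number G \<ge> k) \<and>
         (tree_independence_number G \<ge> 4 * k - 2 \<longrightarrow>
           (\<exists>\<B>. strong_bramble G \<B> \<and> alpha_order G \<B> \<ge> k))"
proof -
  interpret pair_graph G by fact
  show ?thesis
    using alpha_order_le_tree_independence_number
      strong_bramble_if_large_tree_independence_number[OF \<open>k > 0\<close>] by blast
qed

end
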